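(* Let $\widetilde W$ be an $N\times N$ weight matrix whose right Fourier algebra $\mathcal F_R(\widetilde W)$ consists only of operators with diagonal coefficients. Let $A\in\mathcal A$, $T(x)=e^{Ax}$, and $W(x)=T(x)\widetilde W(x)T(x)^*$. Then $\mathcal D(W)\subset T(x)\,\mathcal D(\widetilde W)\,T(x)^{-1}$.
   Context: $\mathcal A=\{\sum_{j=1}^{\lfloor N/2\rfloor}m_jE_{2j-1,2j}+\sum_{j=1}^{\lfloor (N-1)/2\rfloor}n_jE_{2j+1,2j}: m_j,n_j\in\mathbb C\}$, where $E_{s,t}$ are matrix units; note $A^2=0$ so $e^{Ax}=I+Ax$. Weight matrices are smooth a.e. positive definite matrix functions on an interval with finite moments (with standing decay assumptions: $W^{(n)}$ decays exponentially at infinity and $W^{(n)}p_n$ has finite moments for some scalar polynomial $p_n$); $\langle P,Q\rangle_W=\int PWQ^*dx$; $(P_n)$ monic orthogonal polynomials. Differential operators act on the right: $P\cdot\sum_j\partial^jF_j=\sum_j\partial^j(P)F_j$. $\mathcal D(W)$: operators with matrix polynomial coefficients with $P_n\cdot D=\Lambda_n(D)P_n$ for all $n$, $\Lambda_n(D)$ constant matrices. $\mathcal F_R(W)$: operators $\mathfrak D$ with polynomial coefficients having a $W$-adjoint $\mathfrak D^\dagger$ (i.e. $\langle P\cdot\mathfrak D,Q\rangle_W=\langle P,Q\cdot\mathfrak D^\dagger\rangle_W$ for all matrix polynomials $P,Q$) with polynomial coefficients. *)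

theory Defs
  imports "HOL-Analysis.Analysis" "HOL-Computational_Algebra.Polynomial"
begin

definition pos :: "'n::{finite,linorder} \<Rightarrow> nat" where
  "pos i = card {j. j < i} + 1"

definition cadj :: "complex^'n^'m \<Rightarrow> complex^'m^'n" where
  "cadj M = (\<chi> i j. cnj (M $ j $ i))"

definition mat_posdef :: "complex^'n^'n \<Rightarrow> bool" where
  "mat_posdef M \<longleftrightarrow> cadj M = M \<and>
     (\<forall>v::complex^'n. v \<noteq> 0 \<longrightarrow> 0 < Re (\<Sum>i\<in>UNIV. \<Sum>j\<in>UNIV. cnj (v $ i) * M $ i $ j * v $ j))"

text \<open>The algebra A: span of E_{2j-1,2j} and E_{2j+1,2j}, i.e. matrices whose only
  nonzero entries are in an odd row and an adjacent column.\<close>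
definition algA :: "(complex^('n::{finite,linorder})^('n::{finite,linorder})) set" where
  "algA = {M. \<forall>i j. M $ i $ j \<noteq> 0 \<longrightarrow>
      odd (pos i) \<and> (pos j = pos i + 1 \<or> pos i = pos j + 1)}"

text \<open>T(x) = e^{Ax} = I + x A  (A^2 = 0 for A in algA).\<close>
definition Tmat :: "complex^'n^'n \<Rightarrow> real \<Rightarrow> complex^'n^'n" where
  "Tmat A x = mat 1 + x *\<^sub>R A"

definition vderiv :: "(real \<Rightarrow> 'a::real_normed_vector) \<Rightarrow> real \<Rightarrow> 'a" where
  "vderiv f = (\<lambda>t. vector_derivative f (at t))"

definition smooth_on :: "real set \<Rightarrow> (real \<Rightarrow> 'a::real_normed_vector) \<Rightarrow> bool" where
  "smooth_on S f \<longleftrightarrow> (\<forall>k. \<forall>x\<in>S. (vderiv ^^ k) f differentiable (at x))"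

definition weight_matrix :: "real set \<Rightarrow> (real \<Rightarrow> complex^'n^'n) \<Rightarrow> bool" where
  "weight_matrix I W \<longleftrightarrow>
     is_interval I \<and> interior I \<noteq> {} \<and>
     smooth_on (interior I) W \<and>
     (AE x in lborel. x \<in> I \<longrightarrow> mat_posdef (W x)) \<and>
     (\<forall>k::nat. set_integrable lborel I (\<lambda>x. (x ^ k) *\<^sub>R W x)) \<and>
     \<comment> \<open>standing decay assumptions\<close>
     (\<forall>n. \<exists>c>0. ((\<lambda>x. exp (c * \<bar>x\<bar>) *\<^sub>R (vderiv ^^ n) W x) \<longlongrightarrow> 0)
                    (inf at_infinity (principal I))) \<and>
     (\<forall>n. \<exists>p::real poly. p \<noteq> 0 \<and>
        (\<forall>k::nat. set_integrable lborel I (\<lambda>x. (x ^ k * poly p x) *\<^sub>R (vderiv ^^ n) W x)))"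

type_synonym 'n mpoly = "complex poly^'n^'n"

definition meval :: "('n::finite) mpoly \<Rightarrow> real \<Rightarrow> complex^'n^'n" where
  "meval P x = (\<chi> i j. poly (P $ i $ j) (complex_of_real x))"

definition mderiv :: "('n::finite) mpoly \<Rightarrow> 'n mpoly" where
  "mderiv P = (\<chi> i j. pderiv (P $ i $ j))"

definition mconst :: "complex^'n^'n \<Rightarrow> ('n::finite) mpoly" where
  "mconst M = (\<chi> i j. [:M $ i $ j:])"

definition mcoeff :: "('n::finite) mpoly \<Rightarrow> nat \<Rightarrow> complex^'n^'n" where
  "mcoeff P k = (\<chi> i j. coeff (P $ i $ j) k)"

definition Tpoly :: "complex^'n^'n \<Rightarrow> ('n::finite) mpoly" where
  "Tpoly A = (\<chi> i j. [:(mat 1 :: complex^'n^'n) $ i $ j, A $ i $ j:])"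

definition Tinvpoly :: "complex^'n^'n \<Rightarrow> ('n::finite) mpoly" where
  "Tinvpoly A = (\<chi> i j. [:(mat 1 :: complex^'n^'n) $ i $ j, - A $ i $ j:])"

definition ip :: "real set \<Rightarrow> (real \<Rightarrow> complex^'n^'n) \<Rightarrow> ('n::finite) mpoly \<Rightarrow> 'n mpoly \<Rightarrow> complex^'n^'n" where
  "ip I W P Q = (LINT x:I|lborel. meval P x ** W x ** cadj (meval Q x))"

definition monic_OPS :: "real set \<Rightarrow> (real \<Rightarrow> complex^'n^'n) \<Rightarrow> (nat \<Rightarrow> ('n::finite) mpoly) \<Rightarrow> bool" where
  "monic_OPS I W P \<longleftrightarrow>
     (\<forall>n. mcoeff (P n) n = mat 1 \<and> (\<forall>k>n. mcoeff (P n) k = 0)) \<and>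
     (\<forall>n m. n \<noteq> m \<longrightarrow> ip I W (P n) (P m) = 0)"

section \<open>Differential operators  D = sum_j d^j F_j, acting on the right\<close>

type_synonym 'n mop = "nat \<Rightarrow> 'n mpoly"

definition diff_op :: "('n::finite) mop \<Rightarrow> bool" where
  "diff_op D \<longleftrightarrow> finite {j. D j \<noteq> 0}"

definition mop_apply :: "('n::finite) mpoly \<Rightarrow> 'n mop \<Rightarrow> 'n mpoly" where
  "mop_apply P D = (\<Sum>j\<in>{j. D j \<noteq> 0}. (mderiv ^^ j) P ** D j)"

definition algD :: "real set \<Rightarrow> (real \<Rightarrow> complex^'n^'n) \<Rightarrow> ('n::finite) mop set" where
  "algD I W = {D. diff_op D \<and>
     (\<forall>P. monic_OPS I W P \<longrightarrow> (\<forall>n. \<exists>\<Lambda>. mop_apply (P n) D = mconst \<Lambda> ** P n))}"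

definition fourierR :: "real set \<Rightarrow> (real \<Rightarrow> complex^'n^'n) \<Rightarrow> ('n::finite) mop set" where
  "fourierR I W = {D. diff_op D \<and> (\<exists>D'. diff_op D' \<and>
     (\<forall>P Q. ip I W (mop_apply P D) Q = ip I W P (mop_apply Q D')))}"

definition diag_coeffs :: "('n::finite) mop \<Rightarrow> bool" where
  "diag_coeffs D \<longleftrightarrow> (\<forall>j i k. i \<noteq> k \<longrightarrow> D j $ i $ k = 0)"

text \<open>D is the operator T Dt T^{-1}: F . D = ((F T) . Dt) T^{-1}.\<close>
definition conj_op :: "complex^'n^'n \<Rightarrow> ('n::finite) mop \<Rightarrow> 'n mop \<Rightarrow> bool" where
  "conj_op A Dt D \<longleftrightarrow>
     (\<forall>F. mop_apply F D = mop_apply (F ** Tpoly A) Dt ** Tinvpoly A)"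

end

theory Submission
  imports Defs
begin

text \<open>
  An operator \<open>D\<close> in \<open>\<D>(W)\<close> has an adjoint that again preserves degrees: on the orthogonal basis
  it is given by \<open>P\<^sub>n \<mapsto> S\<^sub>n \<Lambda>\<^sub>n\<^sup>* S\<^sub>n\<^sup>-\<^sup>1 P\<^sub>n\<close> with \<open>S\<^sub>n = \<langle>P\<^sub>n, P\<^sub>n\<rangle>\<close>.  Since multiplication by \<open>x\<close> is symmetric,
  a vanishing iterated commutator of \<open>D\<close> with \<open>x\<close> passes to the adjoint, so the adjoint is a
  differential operator as well.  Conjugating by \<open>T\<close> turns both into elements of the Fourier
  algebra of \<open>Wt\<close>, which are diagonal by hypothesis.  As \<open>A\<close> maps odd to even positions only, a
  diagonal operator inherits degree preservation from its conjugate, and a degree preserving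
  operator with degree preserving adjoint has the orthogonal polynomials as eigenfunctions.
\<close>

section \<open>Matrix polynomials\<close>

definition mX :: "('n::finite) mpoly \<Rightarrow> 'n mpoly" where
  "mX P = (\<chi> i j. pCons 0 (P $ i $ j))"

definition mXpow :: "nat \<Rightarrow> ('n::finite) mpoly" where
  "mXpow n = (\<chi> i j. if i = j then monom 1 n else 0)"

definition mdeg_le :: "('n::finite) mpoly \<Rightarrow> nat \<Rightarrow> bool" where
  "mdeg_le P n \<longleftrightarrow> (\<forall>k>n. mcoeff P k = 0)"

text \<open>Operators act on the right and so commute with constant matrices on the left; this is
  linearity over that matrix ring.\<close>

definition left_linear :: "(('n::finite) mpoly \<Rightarrow> 'n mpoly) \<Rightarrow> bool" where
  "left_linear \<phi> \<longleftrightarrow> (\<forall>P Q. \<phi> (P + Q) = \<phi> P + \<phi> Q) \<and>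
     (\<forall>M P. \<phi> (mconst M ** P) = mconst M ** \<phi> P)"

lemma matrix_mult_nth: "(M ** N) $ i $ j = (\<Sum>k\<in>UNIV. M $ i $ k * N $ k $ j)"
  by (simp add: matrix_matrix_mult_def)

lemma matrix_diff_ldistrib:
  fixes M :: "'a::ring_1^'n^'m"
  shows "M ** (N - K) = M ** N - M ** K"
  by (simp add: vec_eq_iff matrix_mult_nth sum_subtractf algebra_simps)

lemma matrix_diff_rdistrib:
  fixes M :: "'a::ring_1^'n^'m"
  shows "(M - N) ** K = M ** K - N ** K"
  by (simp add: vec_eq_iff matrix_mult_nth sum_subtractf algebra_simps)

lemma matrix_add_rdistrib:
  fixes M :: "'a::ring_1^'n^'m"
  shows "(M + N) ** K = M ** K + N ** K"
  by (simp add: vec_eq_iff matrix_mult_nth sum.distrib algebra_simps)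

lemma matrix_sum_ldistrib:
  fixes M :: "'a::ring_1^'n^'m"
  shows "M ** (\<Sum>k\<in>S. f k) = (\<Sum>k\<in>S. M ** f k)"
  by (induction S rule: infinite_finite_induct) (auto simp: matrix_add_ldistrib)

lemma matrix_sum_rdistrib:
  fixes K :: "'a::ring_1^'n^'m"
  shows "(\<Sum>k\<in>S. f k) ** K = (\<Sum>k\<in>S. f k ** K)"
  by (induction S rule: infinite_finite_induct) (auto simp: matrix_add_rdistrib)

lemma mcoeff_simps [simp]:
  "mcoeff 0 k = 0"
  "mcoeff (P + Q) k = mcoeff P k + mcoeff Q k"
  "mcoeff (P - Q) k = mcoeff P k - mcoeff Q k"
  "mcoeff (mXpow n) k = (if k = n then mat 1 else 0)"
  by (auto simp: mcoeff_def vec_eq_iff mXpow_def mat_def)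

lemma mcoeff_mconst_mult [simp]: "mcoeff (mconst M ** P) k = M ** mcoeff P k"
  by (simp add: mcoeff_def vec_eq_iff mconst_def matrix_mult_nth coeff_sum)

lemma mcoeff_sum: "mcoeff (\<Sum>s\<in>S. f s) k = (\<Sum>s\<in>S. mcoeff (f s) k)"
  by (induction S rule: infinite_finite_induct) auto

lemma mpoly_eqI: "(\<And>k. mcoeff P k = mcoeff Q k) \<Longrightarrow> P = Q"
  by (simp add: mcoeff_def vec_eq_iff poly_eq_iff)

lemma mconst_simps [simp]:
  "mconst 0 = 0"
  "mconst (mat 1) = mat 1"
  by (auto simp: mconst_def vec_eq_iff mat_def)

lemma mconst_mult: "mconst (M ** N) = mconst M ** mconst N"
proof -
  have "[:sum f S:] = (\<Sum>s\<in>S. [:f s:])" for f :: "'a \<Rightarrow> complex" and S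
    by (simp add: poly_eq_iff coeff_sum coeff_pCons split: nat.split)
  then show ?thesis
    by (simp add: mconst_def vec_eq_iff matrix_mult_nth mult.commute)
qed

lemma ex_mdeg_le: "\<exists>n. mdeg_le P n"
proof -
  \<comment> \<open>The sum of all entry degrees is a crude common bound.\<close>
  have "degree (P $ i $ j) \<le> (\<Sum>i\<in>UNIV. \<Sum>j\<in>UNIV. degree (P $ i $ j))" for i j
    using member_le_sum[of i UNIV "\<lambda>i. \<Sum>j\<in>UNIV. degree (P $ i $ j)"]
      member_le_sum[of j UNIV "\<lambda>j. degree (P $ i $ j)"] by simp
  then show ?thesis
    unfolding mdeg_le_def mcoeff_def vec_eq_iff
    by (intro exI[of _ "\<Sum>i\<in>UNIV. \<Sum>j\<in>UNIV. degree (P $ i $ j)"])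
      (auto intro!: coeff_eq_0 intro: le_less_trans)
qed

lemma mdeg_le_entry: "mdeg_le P n \<longleftrightarrow> (\<forall>i j. \<forall>k>n. coeff (P $ i $ j) k = 0)"
  by (auto simp: mdeg_le_def mcoeff_def vec_eq_iff)

lemma mdeg_le_sum: "(\<And>s. s \<in> S \<Longrightarrow> mdeg_le (f s) n) \<Longrightarrow> mdeg_le (\<Sum>s\<in>S. f s) n"
  by (simp add: mdeg_le_def mcoeff_sum)

lemma mdeg_le_mconst_mult: "mdeg_le P n \<Longrightarrow> mdeg_le (mconst M ** P) n"
  by (simp add: mdeg_le_def)

lemma mdeg_le_mono: "mdeg_le P m \<Longrightarrow> m \<le> n \<Longrightarrow> mdeg_le P n"
  by (auto simp: mdeg_le_def)

lemma mX_mult: "mX P ** Q = mX (P ** Q)" "P ** mX Q = mX (P ** Q)"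
proof -
  have "pCons 0 (sum f S) = (\<Sum>s\<in>S. pCons 0 (f s))" for f :: "'a \<Rightarrow> complex poly" and S
    by (simp add: poly_eq_iff coeff_sum coeff_pCons split: nat.split)
  then show "mX P ** Q = mX (P ** Q)" "P ** mX Q = mX (P ** Q)"
    by (simp_all add: mX_def vec_eq_iff matrix_mult_nth)
qed

lemma mX_add [simp]: "mX (P + Q) = mX P + mX Q"
  and mX_diff [simp]: "mX (P - Q) = mX P - mX Q"
  and mX_0 [simp]: "mX 0 = 0"
  by (simp_all add: mX_def vec_eq_iff)

text \<open>Horner's scheme: peeling off the constant term leaves \<open>x\<close> times a
  polynomial with one coefficient fewer.\<close>

lemma mpoly_induct [case_names 0 step]:
  assumes "R 0" and step: "\<And>M Q. R Q \<Longrightarrow> R (mconst M + mX Q)"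
  shows "R (P :: ('n::finite) mpoly)"
proof -
  have *: "\<forall>P. (\<forall>k\<ge>n. mcoeff P k = 0) \<longrightarrow> R P" for n
  proof (induction n)
    case 0
    show ?case
    proof (intro allI impI)
      fix P :: "'n mpoly"
      assume "\<forall>k\<ge>0. mcoeff P k = 0"
      then have "P = 0" by (intro mpoly_eqI) simp
      then show "R P" using assms(1) by simp
    qed
  next
    case (Suc n)
    show ?case
    proof (intro allI impI)
      fix P :: "'n mpoly"
      assume P: "\<forall>k\<ge>Suc n. mcoeff P k = 0"
      define Q :: "'n mpoly" where "Q = (\<chi> i j. poly_shift 1 (P $ i $ j))"
      have "mcoeff Q k = mcoeff P (Suc k)" for k
        by (simp add: Q_def mcoeff_def coeff_poly_shift)
      with P Suc.IH have "R Q" by simp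
      have "P = mconst (mcoeff P 0) + mX Q"
        by (simp add: vec_eq_iff mX_def mconst_def mcoeff_def Q_def poly_eq_iff coeff_pCons
            coeff_poly_shift split: nat.split)
      then show "R P" using step[OF \<open>R Q\<close>] by metis
    qed
  qed
  obtain n where "mdeg_le P n" using ex_mdeg_le by blast
  then show ?thesis using *[of "Suc n"] by (auto simp: mdeg_le_def)
qed

section \<open>Maps linear over constant matrices on the left\<close>

lemma left_linearI:
  assumes "\<And>P Q. \<phi> (P + Q) = \<phi> P + \<phi> Q" "\<And>M P. \<phi> (mconst M ** P) = mconst M ** \<phi> P"
  shows "left_linear \<phi>"
  using assms by (simp add: left_linear_def)

lemma left_linearD:
  assumes "left_linear \<phi>"
  shows "\<phi> (P + Q) = \<phi> P + \<phi> Q" "\<phi> (mconst M ** P) = mconst M ** \<phi> P"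
    "\<phi> 0 = 0" "\<phi> (P - Q) = \<phi> P - \<phi> Q"
proof -
  show *: "\<phi> (P + Q) = \<phi> P + \<phi> Q" "\<phi> (mconst M ** P) = mconst M ** \<phi> P" for P Q M
    using assms by (auto simp: left_linear_def)
  show "\<phi> 0 = 0" using *(1)[of 0 0] by simp
  show "\<phi> (P - Q) = \<phi> P - \<phi> Q" using *(1)[of "P - Q" Q] by (simp add: algebra_simps)
qed

lemma left_linear_sum: "left_linear \<phi> \<Longrightarrow> \<phi> (\<Sum>s\<in>S. f s) = (\<Sum>s\<in>S. \<phi> (f s))"
  by (induction S rule: infinite_finite_induct) (auto simp: left_linearD)

lemma left_linear_diff:
  "left_linear \<phi> \<Longrightarrow> left_linear \<psi> \<Longrightarrow> left_linear (\<lambda>P. \<phi> P - \<psi> P)"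
  by (simp add: left_linear_def matrix_diff_ldistrib)

lemma left_linear_conj:
  "left_linear \<phi> \<Longrightarrow> left_linear (\<lambda>P. \<phi> (P ** U) ** V)"
  by (simp add: left_linear_def matrix_add_rdistrib flip: matrix_mul_assoc)

lemma left_linear_commutator:
  "left_linear \<phi> \<Longrightarrow> left_linear (\<lambda>P. \<phi> (mX P) - mX (\<phi> P))"
  by (simp add: left_linear_def matrix_diff_ldistrib flip: mX_mult(2))

section \<open>Differential operators as maps with nilpotent commutators\<close>

text \<open>\<open>dop_order n \<phi>\<close> says that the \<open>n\<close>-fold commutator of \<open>\<phi>\<close> with multiplication by \<open>x\<close>
  vanishes, which characterises the differential operators of order less than \<open>n\<close>
  without reference to coefficients.\<close>

primrec dop_order :: "nat \<Rightarrow> (('n::finite) mpoly \<Rightarrow> 'n mpoly) \<Rightarrow> bool" where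
  "dop_order 0 \<phi> \<longleftrightarrow> (\<forall>P. \<phi> P = 0)"
| "dop_order (Suc n) \<phi> \<longleftrightarrow> dop_order n (\<lambda>P. \<phi> (mX P) - mX (\<phi> P))"

text \<open>The adjoint of a commutator with \<open>x\<close> is minus the commutator of the
  adjoint; this absorbs the sign.\<close>

lemma dop_order_uminus: "dop_order n \<phi> \<Longrightarrow> dop_order n (\<lambda>P. - \<phi> P)"
proof (induction n arbitrary: \<phi>)
  case (Suc n)
  have "- \<phi> (mX P) - mX (- \<phi> P) = - (\<phi> (mX P) - mX (\<phi> P))" for P
    using mX_diff[of 0 "\<phi> P"] by simp
  with Suc.IH[of "\<lambda>P. \<phi> (mX P) - mX (\<phi> P)"] Suc.prems show ?case
    by (simp only: dop_order.simps)
qed simp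

text \<open>Multiplication by \<open>x\<close> is scalar and passes through \<open>U\<close> and
  \<open>V\<close>, so the commutator of the sandwiched map is the sandwiched commutator.\<close>

lemma dop_order_conj: "dop_order n \<phi> \<Longrightarrow> dop_order n (\<lambda>P. \<phi> (P ** U) ** V)"
proof (induction n arbitrary: \<phi>)
  case (Suc n)
  have "\<phi> (mX P ** U) ** V - mX (\<phi> (P ** U) ** V) =
      (\<phi> (mX (P ** U)) - mX (\<phi> (P ** U))) ** V" for P
    by (simp add: mX_mult matrix_diff_rdistrib)
  then show ?case using Suc by simp
qed simp

section \<open>The derivative and its commutator with \<open>x\<close>\<close>

lemma mderiv_add: "mderiv (P + Q) = mderiv P + mderiv Q"
  by (simp add: mderiv_def vec_eq_iff pderiv_add)

lemma mderiv_mconst_mult: "mderiv (mconst M ** P) = mconst M ** mderiv P"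
proof -
  have "pderiv (sum f S) = (\<Sum>s\<in>S. pderiv (f s))" for f :: "'a \<Rightarrow> complex poly" and S
    by (induction S rule: infinite_finite_induct) (auto simp: pderiv_add)
  then show ?thesis
    by (simp add: mderiv_def mconst_def vec_eq_iff matrix_mult_nth pderiv_smult)
qed

lemma mderiv_mX: "mderiv (mX P) = P + mX (mderiv P)"
  by (simp add: mderiv_def mX_def vec_eq_iff pderiv_pCons)

lemma left_linear_mderiv_funpow: "left_linear (mderiv ^^ j)"
  by (induction j) (simp_all add: left_linear_def mderiv_add mderiv_mconst_mult)

text \<open>Scalars enter as \<open>mconst (mat c)\<close>, so that they multiply matrix polynomials
  through \<open>**\<close>.\<close>

lemma mconst_mat_mult_nth: "(mconst (mat c) ** P) $ i $ j = smult c (P $ i $ j)"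
  by (simp add: matrix_mult_nth mconst_def mat_def if_distrib [of "\<lambda>c. [:c:]"]
      if_distrib [of "\<lambda>a. a * _"] cong: if_cong)

lemma mconst_mat_commute: "P ** mconst (mat c) = mconst (mat c) ** P"
  by (simp add: vec_eq_iff mconst_mat_mult_nth)
    (simp add: matrix_mult_nth mconst_def mat_def if_distrib [of "\<lambda>c. [:c:]"]
      if_distrib [of "\<lambda>a. _ * a"] cong: if_cong)

text \<open>Leibniz rule for the product with \<open>x\<close>, whose second derivative vanishes;
  the order \<open>Suc j\<close> avoids a truncated \<open>j - 1\<close>.\<close>

lemma mderiv_funpow_mX:
  "(mderiv ^^ Suc j) (mX P) =
    mX ((mderiv ^^ Suc j) P) + mconst (mat (of_nat (Suc j))) ** (mderiv ^^ j) P"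
proof (induction j)
  case 0
  show ?case by (simp add: mderiv_mX)
next
  case (Suc j)
  have "(mderiv ^^ Suc (Suc j)) (mX P) = mderiv ((mderiv ^^ Suc j) (mX P))"
    by simp
  also have "\<dots> = mX ((mderiv ^^ Suc (Suc j)) P) +
      ((mderiv ^^ Suc j) P + mconst (mat (of_nat (Suc j))) ** (mderiv ^^ Suc j) P)"
    unfolding Suc.IH by (simp add: mderiv_add mderiv_mX mderiv_mconst_mult)
  also have "Q + mconst (mat (of_nat k)) ** Q = mconst (mat (of_nat (Suc k))) ** Q"
    for Q :: "'a mpoly" and k
    by (simp add: vec_eq_iff mconst_mat_mult_nth smult_add_left)
  finally show ?case .
qed

text \<open>Replaces the support of \<open>D\<close>, which varies with \<open>D\<close>, by a fixed
  range, so that sums for different operators can be compared.\<close>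

lemma mop_apply_lessThan:
  assumes "\<forall>j\<ge>n. D j = 0"
  shows "mop_apply P D = (\<Sum>j<n. (mderiv ^^ j) P ** D j)"
  unfolding mop_apply_def
  by (rule sum.mono_neutral_left) (use assms in \<open>auto simp: not_le[symmetric]\<close>)

lemma diff_op_iff: "diff_op D \<longleftrightarrow> (\<exists>n. \<forall>j\<ge>n. D j = 0)"
proof
  assume "diff_op D"
  then obtain n where "\<forall>j\<in>{j. D j \<noteq> 0}. j < n"
    unfolding diff_op_def using finite_nat_set_iff_bounded by blast
  then show "\<exists>n. \<forall>j\<ge>n. D j = 0" by (metis mem_Collect_eq not_le)
next
  assume "\<exists>n. \<forall>j\<ge>n. D j = 0"
  then obtain n where "\<forall>j\<ge>n. D j = 0" by blast
  then have "{j. D j \<noteq> 0} \<subseteq> {..<n}" by (auto simp: not_le[symmetric])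
  then show "diff_op D" unfolding diff_op_def using finite_subset by blast
qed

lemma left_linear_mop_apply: "left_linear (\<lambda>P. mop_apply P D)"
  by (simp add: mop_apply_def left_linear_def left_linearD[OF left_linear_mderiv_funpow]
      matrix_add_rdistrib sum.distrib matrix_sum_ldistrib matrix_mul_assoc)

text \<open>Commuting with \<open>x\<close> differentiates the operator formally in the derivation
  symbol: coefficients move down one place with factor \<open>j + 1\<close>.\<close>

lemma mop_apply_commutator:
  assumes "diff_op D"
  shows "mop_apply (mX P) D - mX (mop_apply P D) =
    mop_apply P (\<lambda>j. mconst (mat (of_nat (Suc j))) ** D (Suc j))"
proof -
  obtain n where n: "\<forall>j\<ge>n. D j = 0" using assms diff_op_iff by blast
  have mX_sum: "mX (sum f S) = (\<Sum>s\<in>S. mX (f s))" for f :: "nat \<Rightarrow> 'a mpoly" and S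
    by (induction S rule: infinite_finite_induct) auto
  have "mop_apply (mX P) D - mX (mop_apply P D) =
      (\<Sum>j<Suc n. ((mderiv ^^ j) (mX P) - mX ((mderiv ^^ j) P)) ** D j)"
    using n by (simp add: mop_apply_lessThan[where n = "Suc n"] mX_sum mX_mult
        matrix_diff_rdistrib sum_subtractf del: sum.lessThan_Suc)
  \<comment> \<open>The term of order 0 commutes with \<open>x\<close> and drops out, which shifts
    the index.\<close>
  also have "\<dots> = (\<Sum>j<n. (mconst (mat (of_nat (Suc j))) ** (mderiv ^^ j) P) ** D (Suc j))"
    by (simp only: sum.lessThan_Suc_shift mderiv_funpow_mX) simp
  also have "\<dots> = (\<Sum>j<n. (mderiv ^^ j) P ** (mconst (mat (of_nat (Suc j))) ** D (Suc j)))"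
    by (simp only: matrix_mul_assoc mconst_mat_commute)
  also have "\<dots> = mop_apply P (\<lambda>j. mconst (mat (of_nat (Suc j))) ** D (Suc j))"
    using n by (subst mop_apply_lessThan[of n]) auto
  finally show ?thesis .
qed

lemma dop_order_mop_apply: "\<forall>j\<ge>n. D j = 0 \<Longrightarrow> dop_order n (\<lambda>P. mop_apply P D)"
proof (induction n arbitrary: D)
  case 0
  then show ?case by (simp add: mop_apply_def)
next
  case (Suc n)
  then have "diff_op D" using diff_op_iff by blast
  with Suc show ?case by (simp add: mop_apply_commutator)
qed

text \<open>By induction the commutator with \<open>x\<close> is an operator \<open>E\<close>.
  Integrating \<open>E\<close> formally gives \<open>D\<close>, and the difference of
  \<open>\<phi>\<close> and \<open>D\<close> commutes with \<open>x\<close> and kills the identity,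
  hence vanishes.\<close>

lemma dop_order_imp_diff_op:
  assumes "left_linear \<phi>" "dop_order n \<phi>"
  shows "\<exists>D. diff_op D \<and> (\<forall>P. \<phi> P = mop_apply P D)"
  using assms
proof (induction n arbitrary: \<phi>)
  case 0
  then show ?case
    by (intro exI[of _ "\<lambda>_. 0"]) (simp add: diff_op_def mop_apply_def)
next
  case (Suc n)
  then obtain E where E: "diff_op E" "\<And>P. \<phi> (mX P) - mX (\<phi> P) = mop_apply P E"
    using Suc.IH[OF left_linear_commutator] by fastforce
  \<comment> \<open>Dividing by \<open>j + 1\<close> undoes the factor of the commutator; the
    constant of integration is fixed by the value of \<open>\<phi>\<close> at the identity.\<close>
  define D where "D = case_nat (\<phi> (mat 1)) (\<lambda>j. mconst (mat (1 / of_nat (Suc j))) ** E j)"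
  obtain k where k: "\<forall>j\<ge>k. E j = 0" using E(1) diff_op_iff by blast
  then have Dk: "\<forall>j\<ge>Suc k. D j = 0" by (auto simp: D_def split: nat.split)
  then have D: "diff_op D" using diff_op_iff by blast
  have DE: "(\<lambda>j. mconst (mat (of_nat (Suc j))) ** D (Suc j)) = E"
    by (rule ext) (simp add: D_def vec_eq_iff mconst_mat_mult_nth del: of_nat_Suc)
  define \<psi> where "\<psi> P = \<phi> P - mop_apply P D" for P
  have lin: "left_linear \<psi>"
    unfolding \<psi>_def using Suc.prems left_linear_mop_apply left_linear_diff by blast
  have \<psi>X: "\<psi> (mX P) = mX (\<psi> P)" for P
    using E(2)[of P] mop_apply_commutator[OF D, of P] unfolding DE \<psi>_def
    by (simp add: algebra_simps)
  have "mderiv (mat 1 :: 'a mpoly) = 0"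
    by (simp add: mderiv_def vec_eq_iff mat_def)
  then have "(mderiv ^^ Suc j) (mat 1 :: 'a mpoly) = 0" for j
    by (induction j) (auto simp: mderiv_def vec_eq_iff)
  then have "mop_apply (mat 1) D = D 0"
    by (simp only: mop_apply_lessThan[OF Dk] sum.lessThan_Suc_shift) simp
  then have \<psi>1: "\<psi> (mat 1) = 0" by (simp add: \<psi>_def D_def)
  have "\<psi> P = 0" for P
  proof (induction P rule: mpoly_induct)
    case 0
    show ?case by (rule left_linearD(3)[OF lin])
  next
    case (step M Q)
    then show ?case
      using left_linearD(1,2)[OF lin] \<psi>1 \<psi>X matrix_mul_rid mX_0
      by (metis add.right_neutral times0_right)
  qed
  then show ?case using D by (auto simp: \<psi>_def)
qed

section \<open>Matrix-valued inner products\<close>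

lemma cadj_simps [simp]:
  "cadj 0 = 0" "cadj (cadj M) = M" "cadj (M + N) = cadj M + cadj N"
  by (simp_all add: cadj_def vec_eq_iff)

lemma cadj_mult: "cadj (M ** N) = cadj N ** cadj M"
  by (simp add: cadj_def vec_eq_iff matrix_mult_nth mult.commute)

text \<open>The form is abstract so that the same lemmas serve both weights.\<close>

definition orthogonal_seq ::
  "(('n::finite) mpoly \<Rightarrow> 'n mpoly \<Rightarrow> complex^'n^'n) \<Rightarrow> (nat \<Rightarrow> 'n mpoly) \<Rightarrow> bool" where
  "orthogonal_seq B P \<longleftrightarrow> (\<forall>n. mcoeff (P n) n = mat 1 \<and> mdeg_le (P n) n) \<and>
     (\<forall>n m. n \<noteq> m \<longrightarrow> B (P n) (P m) = 0)"

lemma monic_OPS_iff: "monic_OPS I W P \<longleftrightarrow> orthogonal_seq (ip I W) P"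
  by (simp add: monic_OPS_def orthogonal_seq_def mdeg_le_def)

text \<open>Coefficients stand on the left, and division by a squared norm becomes right
  multiplication by the inverse of a matrix.\<close>

fun gram_schmidt ::
  "(('n::finite) mpoly \<Rightarrow> 'n mpoly \<Rightarrow> complex^'n^'n) \<Rightarrow> nat \<Rightarrow> 'n mpoly" where
  "gram_schmidt B n = mXpow n - (\<Sum>k<n. mconst (B (mXpow n) (gram_schmidt B k) **
     matrix_inv (B (gram_schmidt B k) (gram_schmidt B k))) ** gram_schmidt B k)"

declare gram_schmidt.simps [simp del]

lemma monic_expansion:
  assumes "\<And>n. mcoeff (P n) n = mat 1" "\<And>n. mdeg_le (P n) n" "mdeg_le Q n"
  shows "\<exists>c. Q = (\<Sum>k\<le>n. mconst (c k) ** P k)"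
proof -
  \<comment> \<open>Counting coefficients instead of degrees makes the zero polynomial the base
    case; each step subtracts the leading coefficient times \<open>P n\<close>.\<close>
  have "\<forall>Q. (\<forall>k\<ge>n. mcoeff Q k = 0) \<longrightarrow> (\<exists>c. Q = (\<Sum>k<n. mconst (c k) ** P k))" for n
  proof (induction n)
    case 0
    show ?case by (auto intro: mpoly_eqI)
  next
    case (Suc n)
    show ?case
    proof (intro allI impI)
      fix Q :: "'a mpoly"
      assume Q: "\<forall>k\<ge>Suc n. mcoeff Q k = 0"
      define Q' where "Q' = Q - mconst (mcoeff Q n) ** P n"
      have "mcoeff Q' k = 0" if "k \<ge> n" for k
      proof (cases "k = n")
        case True
        then show ?thesis by (simp add: Q'_def assms(1))
      next
        case False
        then show ?thesis using Q assms(2)[of n] that by (simp add: Q'_def mdeg_le_def)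
      qed
      then obtain c where "Q' = (\<Sum>k<n. mconst (c k) ** P k)" using Suc.IH by blast
      then have "Q = (\<Sum>k<Suc n. mconst ((c(n := mcoeff Q n)) k) ** P k)"
        by (simp add: Q'_def algebra_simps)
      then show "\<exists>c. Q = (\<Sum>k<Suc n. mconst (c k) ** P k)" by blast
    qed
  qed
  from this[of "Suc n"] show ?thesis
    using assms(3) by (auto simp: mdeg_le_def lessThan_Suc_atMost)
qed

text \<open>The conjugated weight is never shown to satisfy \<open>weight_matrix\<close>; these
  axioms suffice and transfer to it from \<open>Wt\<close>.\<close>

locale matrix_ip =
  fixes B :: "('n::finite) mpoly \<Rightarrow> 'n mpoly \<Rightarrow> complex^'n^'n"
  assumes add_left: "B (P + P') Q = B P Q + B P' Q"
    and mconst_left: "B (mconst M ** P) Q = M ** B P Q"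
    and hermitian: "B Q P = cadj (B P Q)"
    and mX_left: "B (mX P) Q = B P (mX Q)"
    and definite: "B P P = 0 \<Longrightarrow> P = 0"
begin

lemma add_right: "B P (Q + Q') = B P Q + B P Q'"
  by (metis add_left hermitian cadj_simps(3))

lemma mconst_right: "B P (mconst M ** Q) = B P Q ** cadj M"
  by (metis mconst_left hermitian cadj_mult)

lemma zero_left [simp]: "B 0 Q = 0"
  using add_left[of 0 0 Q] by simp

lemma zero_right [simp]: "B Q 0 = 0"
  using add_right[of Q 0 0] by simp

lemma diff_left: "B (P - P') Q = B P Q - B P' Q"
  using add_left[of "P - P'" P' Q] by (simp add: algebra_simps)

lemma diff_right: "B P (Q - Q') = B P Q - B P Q'"
  using add_right[of P "Q - Q'" Q'] by (simp add: algebra_simps)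

lemma sum_left: "B (\<Sum>s\<in>S. f s) Q = (\<Sum>s\<in>S. B (f s) Q)"
  by (induction S rule: infinite_finite_induct) (auto simp: add_left)

lemma sum_right: "B Q (\<Sum>s\<in>S. f s) = (\<Sum>s\<in>S. B Q (f s))"
  by (induction S rule: infinite_finite_induct) (auto simp: add_right)

lemma expansion:
  "B (\<Sum>l\<in>S. mconst (a l) ** P l) (\<Sum>k\<in>S'. mconst (b k) ** P k) =
    (\<Sum>k\<in>S'. \<Sum>l\<in>S. a l ** B (P l) (P k) ** cadj (b k))"
  by (simp add: sum_left sum_right mconst_left mconst_right matrix_sum_rdistrib)

lemma nondegenerate:
  assumes "\<And>F. B F R = B F R'"
  shows "R = R'"
proof -
  have "B (R - R') (R - R') = 0" by (simp add: diff_right assms)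
  then show ?thesis using definite by fastforce
qed

text \<open>A kernel vector of the norm gives a constant \<open>M\<close> such that \<open>M\<close>
  times \<open>P\<close> has norm zero; by definiteness this product vanishes, and so does its
  coefficient \<open>M\<close>.\<close>

lemma monic_norm_invertible:
  assumes "mcoeff P n = mat 1"
  shows "B P P ** matrix_inv (B P P) = mat 1 \<and> matrix_inv (B P P) ** B P P = mat 1"
proof -
  let ?S = "B P P"
  have "x = 0" if x: "?S *v x = 0" for x
  proof -
    \<comment> \<open>Every row is the conjugate of \<open>x\<close>, so every column of
      \<open>cadj M\<close> is \<open>x\<close>.\<close>
    define M :: "complex^'n^'n" where "M = (\<chi> i j. cnj (x $ j))"
    have "(\<Sum>k\<in>UNIV. ?S $ j $ k * x $ k) = 0" for j
      using x by (simp add: vec_eq_iff matrix_vector_mult_def)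
    then have "?S ** cadj M = 0"
      by (simp add: vec_eq_iff matrix_mult_nth cadj_def M_def)
    then have "B (mconst M ** P) (mconst M ** P) = 0"
      by (simp add: mconst_left mconst_right flip: matrix_mul_assoc)
    then have "mcoeff (mconst M ** P) n = 0" using definite by fastforce
    then have "M = 0" by (simp add: assms)
    then show ?thesis by (simp add: vec_eq_iff M_def)
  qed
  then obtain S' where "S' ** ?S = mat 1" using matrix_left_invertible_ker by blast
  then have "\<exists>S'. ?S ** S' = mat 1 \<and> S' ** ?S = mat 1" using matrix_left_right_inverse by blast
  then show ?thesis unfolding matrix_inv_def by (rule someI_ex)
qed

text \<open>Membership in \<open>algD\<close> speaks about all orthogonal sequences, so one must
  exist for it to yield eigenvalues.\<close>

lemma orthogonal_seq_gram_schmidt: "orthogonal_seq B (gram_schmidt B)"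
proof -
  let ?P = "gram_schmidt B"
  \<comment> \<open>The induction covers earlier indices only; Hermitian symmetry supplies the later
    ones.\<close>
  have main: "mcoeff (?P n) n = mat 1 \<and> mdeg_le (?P n) n \<and> (\<forall>m<n. B (?P n) (?P m) = 0)" for n
  proof (induction n rule: less_induct)
    case (less n)
    define c where "c k = B (mXpow n) (?P k) ** matrix_inv (B (?P k) (?P k))" for k
    have Pn: "?P n = mXpow n - (\<Sum>k<n. mconst (c k) ** ?P k)"
      by (subst gram_schmidt.simps) (simp add: c_def)
    have low: "mcoeff (mconst (c k) ** ?P k) j = 0" if "k < n" "j \<ge> n" for k j
      using less[OF that(1)] that by (simp add: mdeg_le_def)
    have orth: "B (?P k) (?P m) = 0" if "k < n" "m < n" "k \<noteq> m" for k m
    proof (cases "m < k")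
      case True
      then show ?thesis using less that by blast
    next
      case False
      then have "B (?P m) (?P k) = 0" using less that by (meson linorder_neqE_nat)
      then show ?thesis using hermitian[of "?P k" "?P m"] by simp
    qed
    have "B (?P n) (?P m) = 0" if "m < n" for m
    proof -
      have "B (?P n) (?P m) = B (mXpow n) (?P m) - (\<Sum>k<n. c k ** B (?P k) (?P m))"
        by (simp add: Pn diff_left sum_left mconst_left)
      also have "(\<Sum>k<n. c k ** B (?P k) (?P m)) = (\<Sum>k<n. if k = m then c m ** B (?P m) (?P m) else 0)"
        using that by (intro sum.cong) (auto simp: orth)
      also have "\<dots> = c m ** B (?P m) (?P m)" using that by simp
      also have "\<dots> = B (mXpow n) (?P m)"
        using monic_norm_invertible[of "?P m" m] less[OF that]
        by (simp add: c_def flip: matrix_mul_assoc)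
      finally show ?thesis by simp
    qed
    then show ?case using low by (simp add: Pn mdeg_le_def mcoeff_sum)
  qed
  have "B (?P n) (?P m) = 0" if "n \<noteq> m" for n m
    using main[of n] main[of m] that hermitian[of "?P n" "?P m"]
    by (cases "m < n") auto
  then show ?thesis using main by (simp add: orthogonal_seq_def)
qed

lemma eigen_degree:
  assumes "orthogonal_seq B P" "left_linear \<phi>" "\<And>n. \<phi> (P n) = mconst (\<Lambda> n) ** P n"
    and "mdeg_le Q n"
  shows "mdeg_le (\<phi> Q) n"
proof -
  obtain c where Q: "Q = (\<Sum>k\<le>n. mconst (c k) ** P k)"
    using monic_expansion[OF _ _ assms(4), of P] assms(1) orthogonal_seq_def by blast
  have P: "mdeg_le (P k) n" if "k \<le> n" for k
    using assms(1) that mdeg_le_mono by (auto simp: orthogonal_seq_def)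
  have "\<phi> Q = (\<Sum>k\<le>n. mconst (c k) ** (mconst (\<Lambda> k) ** P k))"
    by (simp add: Q left_linear_sum assms left_linearD(2)[OF assms(2)])
  then show ?thesis by (auto intro!: mdeg_le_sum mdeg_le_mconst_mult P)
qed

text \<open>Finite expansions reduce the adjoint identity to pairs of basis elements. Linearity and
  degree bounds of the adjoint then follow from the uniqueness of its values.\<close>

lemma eigen_adjoint:
  assumes "orthogonal_seq B P" "left_linear \<phi>" "\<And>n. \<phi> (P n) = mconst (\<Lambda> n) ** P n"
  shows "\<exists>\<phi>'. left_linear \<phi>' \<and> (\<forall>F Q. B (\<phi> F) Q = B F (\<phi>' Q)) \<and>
    (\<forall>n Q. mdeg_le Q n \<longrightarrow> mdeg_le (\<phi>' Q) n)"
proof -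
  have monic: "mcoeff (P n) n = mat 1" "mdeg_le (P n) n" for n
    using assms(1) by (auto simp: orthogonal_seq_def)
  define S where "S n = B (P n) (P n)" for n
  \<comment> \<open>As \<open>S n\<close> is Hermitian, this is the matrix of the overview; keeping
    \<open>cadj\<close> outside avoids the adjoint of an inverse.\<close>
  define M where "M n = cadj (matrix_inv (S n) ** \<Lambda> n ** S n)" for n
  \<comment> \<open>Off the diagonal both sides are zero by orthogonality.\<close>
  have swap: "\<Lambda> l ** B (P l) (P k) = B (P l) (P k) ** cadj (M k)" for k l
  proof (cases "k = l")
    case True
    then show ?thesis
      using monic_norm_invertible[OF monic(1), of l] by (simp add: M_def S_def matrix_mul_assoc)
  next
    case False
    then show ?thesis using assms(1) by (simp add: orthogonal_seq_def)
  qed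
  have ex: "\<exists>R. mdeg_le R n \<and> (\<forall>F. B (\<phi> F) Q = B F R)" if "mdeg_le Q n" for Q n
  proof -
    obtain c where Q: "Q = (\<Sum>k\<le>n. mconst (c k) ** P k)"
      using monic_expansion[OF monic \<open>mdeg_le Q n\<close>] by blast
    define R where "R = (\<Sum>k\<le>n. mconst (c k) ** (mconst (M k) ** P k))"
    have "mdeg_le R n"
      unfolding R_def
      by (auto intro!: mdeg_le_sum mdeg_le_mconst_mult intro: mdeg_le_mono[OF monic(2)])
    moreover have "B (\<phi> F) Q = B F R" for F
    proof -
      obtain m where "mdeg_le F m" using ex_mdeg_le by blast
      then obtain d where F: "F = (\<Sum>l\<le>m. mconst (d l) ** P l)"
        using monic_expansion[OF monic] by blast
      have "\<phi> F = (\<Sum>l\<le>m. mconst (d l ** \<Lambda> l) ** P l)"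
        by (simp add: F left_linear_sum assms left_linearD(2)[OF assms(2)] mconst_mult
            matrix_mul_assoc)
      then have "B (\<phi> F) Q = (\<Sum>k\<le>n. \<Sum>l\<le>m. d l ** \<Lambda> l ** B (P l) (P k) ** cadj (c k))"
        by (simp only: Q expansion)
      also have "\<dots> = (\<Sum>k\<le>n. \<Sum>l\<le>m. d l ** B (P l) (P k) ** cadj (c k ** M k))"
      proof -
        have "d l ** \<Lambda> l ** B (P l) (P k) ** cadj (c k) =
            d l ** (\<Lambda> l ** B (P l) (P k)) ** cadj (c k)" for k l
          by (simp add: matrix_mul_assoc)
        then show ?thesis by (simp add: swap cadj_mult matrix_mul_assoc)
      qed
      also have "\<dots> = B F R"
        by (simp only: F R_def expansion matrix_mul_assoc flip: mconst_mult)
      finally show ?thesis .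
    qed
    ultimately show ?thesis by blast
  qed
  then have "\<forall>Q. \<exists>R. \<forall>F. B (\<phi> F) Q = B F R" using ex_mdeg_le by blast
  then obtain \<phi>' where adj: "\<And>F Q. B (\<phi> F) Q = B F (\<phi>' Q)" by metis
  have "left_linear \<phi>'"
    by (intro left_linearI nondegenerate)
      (simp_all add: add_right mconst_right flip: adj)
  moreover have "mdeg_le (\<phi>' Q) n" if deg: "mdeg_le Q n" for Q n
  proof -
    obtain R where "mdeg_le R n" "\<And>F. B (\<phi> F) Q = B F R" using ex[OF deg] by blast
    moreover from this have "\<phi>' Q = R" by (intro nondegenerate) (simp flip: adj)
    ultimately show ?thesis by simp
  qed
  ultimately show ?thesis using adj by blast
qed

lemma dop_order_adjoint:
  assumes "\<And>F Q. B (\<phi> F) Q = B F (\<phi>' Q)" "dop_order n \<phi>"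
  shows "dop_order n \<phi>'"
  using assms
proof (induction n arbitrary: \<phi> \<phi>')
  case 0
  have "\<phi>' Q = 0" for Q
    using 0 by (intro nondegenerate) (simp flip: 0(1))
  then show ?case by simp
next
  case (Suc n)
  have "B (\<phi> (mX F) - mX (\<phi> F)) Q = B F (mX (\<phi>' Q) - \<phi>' (mX Q))" for F Q
    by (simp add: diff_left diff_right mX_left Suc.prems(1))
  then have "dop_order n (\<lambda>Q. mX (\<phi>' Q) - \<phi>' (mX Q))"
    using Suc.IH[of "\<lambda>F. \<phi> (mX F) - mX (\<phi> F)"] Suc.prems(2) by simp
  from dop_order_uminus[OF this] show ?case by simp
qed

text \<open>The image of \<open>P n\<close> has no component beyond \<open>n\<close>. Its component
  at \<open>m < n\<close> vanishes because \<open>\<phi>' (P m)\<close> has degree at most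
  \<open>m\<close> and is thus orthogonal to \<open>P n\<close>.\<close>

lemma eigen_if_degrees:
  assumes "orthogonal_seq B P" "\<And>F Q. B (\<phi> F) Q = B F (\<phi>' Q)"
    and "\<And>n Q. mdeg_le Q n \<Longrightarrow> mdeg_le (\<phi> Q) n"
    and "\<And>n Q. mdeg_le Q n \<Longrightarrow> mdeg_le (\<phi>' Q) n"
  shows "\<exists>\<Lambda>. \<phi> (P n) = mconst \<Lambda> ** P n"
proof -
  have monic: "mcoeff (P n) n = mat 1" "mdeg_le (P n) n" for n
    using assms(1) by (auto simp: orthogonal_seq_def)
  have orth: "B (P k) (P m) = 0" if "k \<noteq> m" for k m
    using assms(1) that by (auto simp: orthogonal_seq_def)
  obtain c where c: "\<phi> (P n) = (\<Sum>k\<le>n. mconst (c k) ** P k)"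
    using monic_expansion[OF monic assms(3)[OF monic(2)]] by blast
  have "c m = 0" if "m < n" for m
  proof -
    obtain d where d: "\<phi>' (P m) = (\<Sum>k\<le>m. mconst (d k) ** P k)"
      using monic_expansion[OF monic assms(4)[OF monic(2)]] by blast
    have "B (\<phi> (P n)) (P m) = (\<Sum>k\<le>n. c k ** B (P k) (P m))"
      by (simp add: c sum_left mconst_left)
    also have "\<dots> = (\<Sum>k\<le>n. if k = m then c m ** B (P m) (P m) else 0)"
      by (intro sum.cong) (auto simp: orth)
    also have "\<dots> = c m ** B (P m) (P m)" using that by simp
    finally have "c m ** B (P m) (P m) = B (P n) (\<phi>' (P m))" by (simp add: assms(2))
    also have "\<dots> = 0"
      using that by (auto simp: d sum_right mconst_right orth intro!: sum.neutral)
    finally have "c m ** B (P m) (P m) ** matrix_inv (B (P m) (P m)) = 0" by simp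
    then show ?thesis
      using monic_norm_invertible[OF monic(1), of m] by (simp flip: matrix_mul_assoc)
  qed
  then have "(\<Sum>k\<le>n. mconst (c k) ** P k) = (\<Sum>k\<le>n. if k = n then mconst (c n) ** P n else 0)"
    by (intro sum.cong) auto
  then show ?thesis using c by auto
qed

lemma matrix_ip_conj:
  assumes "U ** V = mat 1"
  shows "matrix_ip (\<lambda>P Q. B (P ** U) (Q ** U))"
proof
  fix P assume "B (P ** U) (P ** U) = 0"
  then have "P ** U ** V = 0" using definite by fastforce
  then show "P = 0" using assms by (simp flip: matrix_mul_assoc)
qed (simp_all add: matrix_add_rdistrib add_left mX_mult mX_left mconst_left
    flip: matrix_mul_assoc hermitian)

end

section \<open>The inner product of a weight matrix\<close>

lemma scaleR_matrix_mult:
  fixes M :: "complex^'n^'m"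
  shows "(r *\<^sub>R M) ** N = r *\<^sub>R (M ** N)" "M ** (r *\<^sub>R N) = r *\<^sub>R (M ** N)"
  by (simp_all add: vec_eq_iff matrix_mult_nth scaleR_sum_right)

lemma bounded_linear_matrix_mult_left:
  fixes M :: "complex^'n^'n"
  shows "bounded_linear (\<lambda>X. M ** X :: complex^'n^'n)"
  by (intro linear_conv_bounded_linear[THEN iffD1] linearI)
    (simp_all add: matrix_add_ldistrib scaleR_matrix_mult)

lemma bounded_linear_matrix_mult_right:
  fixes M :: "complex^'n^'n"
  shows "bounded_linear (\<lambda>X. (X :: complex^'n^'n) ** M)"
  by (intro linear_conv_bounded_linear[THEN iffD1] linearI)
    (simp_all add: matrix_add_rdistrib scaleR_matrix_mult)

lemma bounded_linear_cadj: "bounded_linear (cadj :: complex^'n^'n \<Rightarrow> complex^'n^'n)"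
  by (intro linear_conv_bounded_linear[THEN iffD1] linearI) (simp_all add: cadj_def vec_eq_iff)

lemma set_integrable_bounded_linear:
  assumes "bounded_linear T" "set_integrable M S f"
  shows "set_integrable M S (\<lambda>x. T (f x))"
  using integrable_bounded_linear[OF assms[unfolded set_integrable_def]]
  by (simp add: set_integrable_def linear_simps[OF assms(1)])

lemma set_integral_bounded_linear:
  assumes "bounded_linear T" "set_integrable M S f"
  shows "(LINT x:S|M. T (f x)) = T (LINT x:S|M. f x)"
  using integral_bounded_linear[OF assms[unfolded set_integrable_def]]
  by (simp add: set_lebesgue_integral_def linear_simps[OF assms(1)])

lemma meval_simps:
  "meval (P + Q) x = meval P x + meval Q x"
  "meval (mconst M) x = M"
  "meval (P ** Q) x = meval P x ** meval Q x"
  "meval (mX P) x = x *\<^sub>R meval P x"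
  by (simp_all add: meval_def mconst_def mX_def vec_eq_iff matrix_mult_nth poly_sum
      scaleR_conv_of_real[where 'a = complex])

lemma meval_eq_sum:
  assumes "mdeg_le P n"
  shows "meval P x = (\<Sum>k\<le>n. x ^ k *\<^sub>R mcoeff P k)"
proof -
  have "poly (P $ i $ j) (of_real x) = (\<Sum>k\<le>n. x ^ k *\<^sub>R coeff (P $ i $ j) k)" for i j
  proof -
    have "degree (P $ i $ j) \<le> n"
      using assms by (intro degree_le) (auto simp: mdeg_le_entry)
    then have "poly (P $ i $ j) (of_real x) = (\<Sum>k\<le>n. coeff (P $ i $ j) k * of_real x ^ k)"
      unfolding poly_altdef by (intro sum.mono_neutral_left) (auto simp: coeff_eq_0)
    then show ?thesis by (simp add: scaleR_conv_of_real mult.commute)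
  qed
  then show ?thesis by (simp add: meval_def vec_eq_iff mcoeff_def)
qed

text \<open>The integrand is a finite sum of moment integrands between constant matrices.\<close>

lemma set_integrable_ip:
  fixes W :: "real \<Rightarrow> complex^'n^'n"
  assumes "\<And>k. set_integrable lborel I (\<lambda>x. x ^ k *\<^sub>R W x)"
  shows "set_integrable lborel I (\<lambda>x. meval P x ** W x ** cadj (meval Q x))"
proof -
  obtain n m where n: "mdeg_le P n" and m: "mdeg_le Q m" using ex_mdeg_le by blast
  have "meval P x ** W x ** cadj (meval Q x) =
      (\<Sum>l\<le>m. \<Sum>k\<le>n. mcoeff P k ** (x ^ (k + l) *\<^sub>R W x) ** cadj (mcoeff Q l))" for x
    by (simp add: meval_eq_sum[OF n] meval_eq_sum[OF m] matrix_sum_rdistrib matrix_sum_ldistrib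
        scaleR_matrix_mult scaleR_sum_right power_add linear_simps[OF bounded_linear_cadj]
        linear_sum[OF bounded_linear.linear[OF bounded_linear_cadj]] mult.commute)
  moreover have "set_integrable lborel I
      (\<lambda>x. \<Sum>l\<le>m. \<Sum>k\<le>n. mcoeff P k ** (x ^ (k + l) *\<^sub>R W x) ** cadj (mcoeff Q l))"
    unfolding set_integrable_def scaleR_sum_right
    by (intro Bochner_Integration.integrable_sum)
      (fold set_integrable_def, intro set_integrable_bounded_linear[OF bounded_linear_matrix_mult_right]
        set_integrable_bounded_linear[OF bounded_linear_matrix_mult_left] assms)
  ultimately show ?thesis by simp
qed

lemma matrix_ip_weight:
  fixes W :: "real \<Rightarrow> complex^'n^'n"
  assumes "weight_matrix I W"
  shows "matrix_ip (ip I W)"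
proof
  have mom: "set_integrable lborel I (\<lambda>x. x ^ k *\<^sub>R W x)" for k
    using assms by (auto simp: weight_matrix_def)
  have pd: "AE x in lborel. x \<in> I \<longrightarrow> mat_posdef (W x)" and I: "interior I \<noteq> {}"
    using assms by (auto simp: weight_matrix_def)
  note int = set_integrable_ip[OF mom]
  fix P P' Q :: "'n mpoly" and M
  show "ip I W (P + P') Q = ip I W P Q + ip I W P' Q"
    by (simp add: ip_def meval_simps matrix_add_rdistrib set_integral_add int)
  show "ip I W (mconst M ** P) Q = M ** ip I W P Q"
    using set_integral_bounded_linear[OF bounded_linear_matrix_mult_left[of M] int]
    by (simp add: ip_def meval_simps matrix_mul_assoc)
  show "ip I W (mX P) Q = ip I W P (mX Q)"
    by (simp add: ip_def meval_simps scaleR_matrix_mult linear_simps[OF bounded_linear_cadj])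
  \<comment> \<open>\<open>W x\<close> is Hermitian only almost everywhere, hence the comparison of
    integrals up to null sets.\<close>
  have "ip I W Q P = (LINT x:I|lborel. cadj (meval P x ** W x ** cadj (meval Q x)))"
    unfolding ip_def set_lebesgue_integral_def
  proof (rule integral_cong_AE)
    show "AE x in lborel. indicator I x *\<^sub>R (meval Q x ** W x ** cadj (meval P x)) =
        indicator I x *\<^sub>R cadj (meval P x ** W x ** cadj (meval Q x))"
      using pd
    proof eventually_elim
      case (elim x)
      then show ?case
        by (cases "x \<in> I") (auto simp: mat_posdef_def cadj_mult matrix_mul_assoc)
    qed
  qed (use int set_integrable_bounded_linear[OF bounded_linear_cadj int] in
      \<open>auto simp: set_integrable_def\<close>)
  also have "\<dots> = cadj (ip I W P Q)"
    unfolding ip_def by (rule set_integral_bounded_linear[OF bounded_linear_cadj int])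
  finally show "ip I W Q P = cadj (ip I W P Q)" .
  assume zero: "ip I W P P = 0"
  show "P = 0"
  proof (rule ccontr)
    assume "P \<noteq> 0"
    then obtain i j where ij: "P $ i $ j \<noteq> 0" by (auto simp: vec_eq_iff)
    \<comment> \<open>The diagonal entry of a row where \<open>P\<close> is nonzero: there the
      integrand is the quadratic form of \<open>W x\<close> at the conjugated row.\<close>
    define T where "T X = Re (X $ i $ i)" for X :: "complex^'n^'n"
    have T: "bounded_linear T"
      by (intro linear_conv_bounded_linear[THEN iffD1] linearI) (simp_all add: T_def)
    define v where "v x = (\<chi> k. cnj (meval P x $ i $ k))" for x
    have T_eq: "T (meval P x ** W x ** cadj (meval P x)) =
        Re (\<Sum>k\<in>UNIV. \<Sum>l\<in>UNIV. cnj (v x $ k) * W x $ k $ l * v x $ l)" for x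
      unfolding T_def matrix_mult_nth cadj_def v_def sum_distrib_right vec_lambda_beta
      by (subst sum.swap) simp
    have nonneg: "AE x in lborel. 0 \<le> indicator I x *\<^sub>R T (meval P x ** W x ** cadj (meval P x))"
      using pd
    proof eventually_elim
      case (elim x)
      then show ?case
        by (cases "x \<in> I"; cases "v x = 0") (auto simp: T_eq mat_posdef_def less_imp_le)
    qed
    have "(LINT x:I|lborel. T (meval P x ** W x ** cadj (meval P x))) = 0"
      using set_integral_bounded_linear[OF T int, of P P] zero
      by (simp add: ip_def T_def)
    then have "AE x in lborel. indicator I x *\<^sub>R T (meval P x ** W x ** cadj (meval P x)) = 0"
      using integral_nonneg_eq_0_iff_AE[OF set_integrable_bounded_linear[OF T int,
            unfolded set_integrable_def] nonneg]
      by (simp add: set_lebesgue_integral_def)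
    \<comment> \<open>A nonzero entry has finitely many roots, so the vector \<open>v x\<close> is
      nonzero for almost every \<open>x\<close>; positivity would then make the interior of
      \<open>I\<close> a null set.\<close>
    moreover have "AE x in lborel. x \<notin> {x. poly (P $ i $ j) (complex_of_real x) = 0}"
    proof (intro AE_not_in finite_imp_null_set_lborel)
      have "finite (complex_of_real -` {z. poly (P $ i $ j) z = 0})"
        using ij by (intro finite_vimageI poly_roots_finite) (auto simp: inj_on_def)
      then show "finite {x. poly (P $ i $ j) (complex_of_real x) = 0}"
        by (simp add: vimage_def)
    qed
    ultimately have "AE x in lborel. x \<notin> interior I"
      using pd
    proof eventually_elim
      case (elim x)
      show ?case
      proof
        assume "x \<in> interior I"
        then have "x \<in> I" using interior_subset by blast
        with elim have "\<not> 0 < Re (\<Sum>k\<in>UNIV. \<Sum>l\<in>UNIV. cnj (v x $ k) * W x $ k $ l * v x $ l)"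
          by (simp add: T_eq)
        with elim \<open>x \<in> I\<close> have "v x = 0" unfolding mat_posdef_def by blast
        then have "v x $ j = 0" by simp
        with elim show False by (simp add: v_def meval_def)
      qed
    qed
    then have "interior I \<in> null_sets lborel"
      by (subst AE_iff_null_sets) auto
    then have "negligible (interior I)"
      by (simp add: negligible_iff_null_sets null_sets_completionI)
    with I open_not_negligible[of "interior I"] show False by simp
  qed
qed

section \<open>Conjugation by \<open>T\<close>\<close>

lemma algA_nonzero:
  assumes "A \<in> algA" "A $ i $ j \<noteq> 0"
  shows "odd (pos i)" "even (pos j)"
  using assms by (force simp: algA_def)+

text \<open>The position of \<open>j\<close> would be even as a column and odd as a row. Summed,
  this gives that \<open>A\<close> squares to zero; the entrywise form also controls conjugated
  diagonal operators.\<close>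

lemma algA_square:
  assumes "A \<in> algA"
  shows "A $ i $ j * A $ j $ k = 0"
  using algA_nonzero[OF assms] by (metis mult_eq_0_iff)

lemma Tpoly_Tinvpoly:
  assumes "A \<in> algA"
  shows "Tpoly A ** Tinvpoly A = mat 1" "Tinvpoly A ** Tpoly A = mat 1"
proof -
  let ?X = "mX (mconst A)"
  have A2: "A ** A = 0"
    by (simp add: vec_eq_iff matrix_mult_nth algA_square[OF assms])
  have "Tpoly A = mat 1 + ?X" "Tinvpoly A = mat 1 - ?X"
    by (auto simp: Tpoly_def Tinvpoly_def vec_eq_iff mX_def mconst_def mat_def
        one_pCons)
  moreover have "?X ** ?X = 0"
    by (simp add: mX_mult A2 flip: mconst_mult)
  ultimately show "Tpoly A ** Tinvpoly A = mat 1" "Tinvpoly A ** Tpoly A = mat 1"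
    by (simp_all add: matrix_add_rdistrib matrix_diff_ldistrib matrix_add_ldistrib
        matrix_diff_rdistrib)
qed

lemma ip_Tmat:
  "ip I (\<lambda>x. Tmat A x ** W x ** cadj (Tmat A x)) P Q = ip I W (P ** Tpoly A) (Q ** Tpoly A)"
proof -
  have "meval (Tpoly A) x = Tmat A x" for x
    by (simp add: meval_def Tpoly_def Tmat_def vec_eq_iff scaleR_conv_of_real[where 'a = complex])
  then show ?thesis
    by (simp add: ip_def meval_simps cadj_mult matrix_mul_assoc)
qed

text \<open>Diagonal coefficients do not mix columns, so each entry sees a scalar operator.\<close>

lemma mop_apply_diag_nth:
  assumes "diag_coeffs D"
  shows "mop_apply F D $ i $ j =
    (\<Sum>k\<in>{k. D k \<noteq> 0}. (pderiv ^^ k) (F $ i $ j) * D k $ j $ j)"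
proof -
  have deriv: "(mderiv ^^ k) F $ i $ j = (pderiv ^^ k) (F $ i $ j)" for k i j
    by (induction k) (simp_all add: mderiv_def)
  have "((mderiv ^^ k) F ** D k) $ i $ j = (pderiv ^^ k) (F $ i $ j) * D k $ j $ j" for k
  proof -
    have "((mderiv ^^ k) F ** D k) $ i $ j =
        (\<Sum>l\<in>UNIV. if l = j then (pderiv ^^ k) (F $ i $ j) * D k $ j $ j else 0)"
      unfolding matrix_mult_nth
      using assms by (intro sum.cong) (auto simp: diag_coeffs_def deriv)
    then show ?thesis by simp
  qed
  then show ?thesis by (simp add: mop_apply_def)
qed

text \<open>For a matrix \<open>G\<close> with a single nonzero entry \<open>(i, j)\<close>, the operator \<open>T Dt T\<^sup>-\<^sup>1\<close> acts on that
  entry just as \<open>Dt\<close> does: the terms through another column \<open>k\<close> carry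
  \<open>A $ j $ k * A $ k $ j = 0\<close>.\<close>

lemma mdeg_le_diag_conj:
  assumes "diag_coeffs Dt" "A \<in> algA"
    and deg: "\<And>G. mdeg_le G n \<Longrightarrow> mdeg_le (mop_apply (G ** Tpoly A) Dt ** Tinvpoly A) n"
    and "mdeg_le F n"
  shows "mdeg_le (mop_apply F Dt) n"
  unfolding mdeg_le_entry
proof (intro allI impI)
  fix i j m assume "m > n"
  define G :: "'a mpoly" where "G = (\<chi> a b. if a = i \<and> b = j then F $ i $ j else 0)"
  have GT: "(G ** Tpoly A) $ i $ k = F $ i $ j * Tpoly A $ j $ k" for k
    by (simp add: matrix_mult_nth G_def if_distrib[of "\<lambda>a. a * _"] cong: if_cong)
  \<comment> \<open>No position is both odd and even, so the diagonals of \<open>T\<close> and its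
    inverse are constantly 1.\<close>
  have "A $ j $ j = 0" using algA_nonzero[OF assms(2)] by blast
  then have jj: "Tpoly A $ j $ j = 1" "Tinvpoly A $ j $ j = 1"
    by (simp_all add: Tpoly_def Tinvpoly_def mat_def one_pCons)
  have "(mop_apply (G ** Tpoly A) Dt ** Tinvpoly A) $ i $ j =
      (\<Sum>k\<in>UNIV. if k = j then mop_apply F Dt $ i $ j else 0)"
    unfolding matrix_mult_nth
  proof (intro sum.cong refl)
    fix k
    show "mop_apply (G ** Tpoly A) Dt $ i $ k * Tinvpoly A $ k $ j =
        (if k = j then mop_apply F Dt $ i $ j else 0)"
    proof (cases "k = j")
      case True
      then show ?thesis by (simp add: mop_apply_diag_nth[OF assms(1)] GT jj)
    next
      case False
      show ?thesis
      proof (cases "A $ k $ j = 0")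
        case True
        then show ?thesis using False by (simp add: Tinvpoly_def mat_def)
      next
        case neq: False
        then have "A $ j $ k = 0" using algA_square[OF assms(2), of k j k] by simp
        then have "(G ** Tpoly A) $ i $ k = 0" using False unfolding GT by (simp add: Tpoly_def mat_def)
        moreover have "(pderiv ^^ l) 0 = (0 :: complex poly)" for l
          by (induction l) simp_all
        ultimately show ?thesis using False by (simp add: mop_apply_diag_nth[OF assms(1)])
      qed
    qed
  qed
  then have "(mop_apply (G ** Tpoly A) Dt ** Tinvpoly A) $ i $ j = mop_apply F Dt $ i $ j"
    by simp
  moreover have "mdeg_le G n" using assms(4) by (simp add: mdeg_le_entry G_def)
  ultimately show "coeff (mop_apply F Dt $ i $ j) m = 0"
    using deg[of G] \<open>m > n\<close> by (metis mdeg_le_entry)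
qed

theorem theorem3p5:
  fixes I :: "real set" and Wt :: "real \<Rightarrow> complex^('n::{finite,linorder})^('n::{finite,linorder})"
    and A :: "complex^('n::{finite,linorder})^('n::{finite,linorder})"
  assumes "weight_matrix I Wt"
    and "\<forall>D\<in>fourierR I Wt. diag_coeffs D"
    and "A \<in> algA"
  shows "\<forall>D\<in>algD I (\<lambda>x. Tmat A x ** Wt x ** cadj (Tmat A x)).
           \<exists>Dt\<in>algD I Wt. conj_op A Dt D"
proof
  fix D
  let ?W = "\<lambda>x. Tmat A x ** Wt x ** cadj (Tmat A x)"
  let ?T = "Tpoly A" and ?V = "Tinvpoly A"
  assume D: "D \<in> algD I ?W"
  note inv = Tpoly_Tinvpoly[OF assms(3)]
  have canc: "F ** ?T ** ?V = F" "F ** ?V ** ?T = F" for F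
    by (simp_all add: inv flip: matrix_mul_assoc)
  interpret b: matrix_ip "ip I Wt" using assms(1) by (rule matrix_ip_weight)
  interpret w: matrix_ip "ip I ?W"
    unfolding ip_Tmat by (rule b.matrix_ip_conj[OF inv(1)])
  define \<phi> where "\<phi> F = mop_apply F D" for F
  have lin: "left_linear \<phi>" unfolding \<phi>_def by (rule left_linear_mop_apply)
  have "diff_op D" using D by (simp add: algD_def)
  then obtain s where s: "dop_order s \<phi>"
    unfolding \<phi>_def using dop_order_mop_apply diff_op_iff by metis
  define P where "P = gram_schmidt (ip I ?W)"
  have P: "orthogonal_seq (ip I ?W) P"
    unfolding P_def by (rule w.orthogonal_seq_gram_schmidt)
  then have "\<forall>n. \<exists>\<Lambda>. \<phi> (P n) = mconst \<Lambda> ** P n"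
    using D by (auto simp: algD_def monic_OPS_iff \<phi>_def)
  then obtain \<Lambda> where eig: "\<And>n. \<phi> (P n) = mconst (\<Lambda> n) ** P n" by metis
  have deg: "mdeg_le (\<phi> Q) n" if "mdeg_le Q n" for Q n
    using w.eigen_degree[OF P lin eig that] .
  obtain \<phi>' where lin': "left_linear \<phi>'"
    and adj: "\<And>F Q. ip I ?W (\<phi> F) Q = ip I ?W F (\<phi>' Q)"
    and deg': "\<And>n Q. mdeg_le Q n \<Longrightarrow> mdeg_le (\<phi>' Q) n"
    using w.eigen_adjoint[OF P lin eig] by blast
  have s': "dop_order s \<phi>'" using w.dop_order_adjoint[OF adj s] .
  \<comment> \<open>Conjugation keeps linearity and order, so the conjugated map has polynomial
    coefficients.\<close>
  obtain Dt where Dt: "diff_op Dt" "\<And>F. \<phi> (F ** ?V) ** ?T = mop_apply F Dt"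
    using dop_order_imp_diff_op[OF left_linear_conj[OF lin] dop_order_conj[OF s]] by metis
  obtain Dt' where Dt': "diff_op Dt'" "\<And>F. \<phi>' (F ** ?V) ** ?T = mop_apply F Dt'"
    using dop_order_imp_diff_op[OF left_linear_conj[OF lin'] dop_order_conj[OF s']] by metis
  have adj_t: "ip I Wt (mop_apply F Dt) Q = ip I Wt F (mop_apply Q Dt')" for F Q
    using adj[of "F ** ?V" "Q ** ?V"] by (simp add: ip_Tmat canc Dt(2) Dt'(2))
  \<comment> \<open>Hermitian symmetry makes \<open>Dt\<close> the adjoint of \<open>Dt'\<close>, so
    both lie in the Fourier algebra and are diagonal.\<close>
  have adj_t': "ip I Wt (mop_apply F Dt') Q = ip I Wt F (mop_apply Q Dt)" for F Q
    using adj_t[of Q F] b.hermitian by metis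
  have diag: "diag_coeffs Dt" "diag_coeffs Dt'"
    using assms(2) Dt(1) Dt'(1) adj_t adj_t' unfolding fourierR_def by blast+
  \<comment> \<open>Conjugating \<open>Dt\<close> back by \<open>T\<close> returns
    \<open>\<phi>\<close>, which preserves degrees.\<close>
  have deg_t: "mdeg_le (mop_apply F Dt) n" if "mdeg_le F n" for F n
    using mdeg_le_diag_conj[OF diag(1) assms(3) _ that] deg by (simp add: canc flip: Dt(2))
  have deg_t': "mdeg_le (mop_apply F Dt') n" if "mdeg_le F n" for F n
    using mdeg_le_diag_conj[OF diag(2) assms(3) _ that] deg' by (simp add: canc flip: Dt'(2))
  have "Dt \<in> algD I Wt"
    using Dt(1) b.eigen_if_degrees[OF _ adj_t deg_t deg_t']
    by (auto simp: algD_def monic_OPS_iff)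
  moreover have "conj_op A Dt D"
    unfolding conj_op_def by (simp add: canc \<phi>_def flip: Dt(2))
  ultimately show "\<exists>Dt\<in>algD I Wt. conj_op A Dt D" by blast
qed

end
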